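(* Let $S=(a_1,\dots,a_n),(b_1,\dots,b_{n'})$ be a sequence of positive integers and let $F=F_E\cup F_N$ be a set of fixed edges and non-edges such that $F$ is a forest. Let $G=(V,U,E)$ and $G'=(V,U,E')$ be two different $F$-fixed realisations of $S$. Then there exist $F$-fixed realisations $G_1,\dots,G_k$ of $S$ with $G_1=G$, $G_k=G'$ and $k\le\frac12|G\triangle G'|$ such that, for every $1\le i<k$, $|G_i\triangle G_{i+1}|\le 6$ and $G_i\triangle G_{i+1}$ corresponds to a $4$-swap or a $6$-swap of $G_i$.
   Context: Let $V=\{v_1,\dots,v_n\}$ and $U=\{u_1,\dots,u_{n'}\}$ be disjoint finite vertex sets. $F_E$ and $F_N$ are sets of vertex pairs $\{v_i,u_j\}$ with $v_i\in V$, $u_j\in U$ (fixed edges and fixed non-edges), and $F=F_E\cup F_N$. The set $F$ is regarded as the edge set of a bipartite graph on $V\cup U$; "$F$ is a forest" means that this graph is acyclic. An $F$-fixed realisation of $S$ is a labeled simple bipartite graph $G=(V,U,E)$ (all edges between $V$ and $U$) with $d_G(v_i)=a_i$ for all $v_i\in V$, $d_G(u_j)=b_j$ for all $u_j\in U$, $F_E\subseteq E$ and $F_N\cap E=\emptyset$. For realisations $G,G'$, $G\triangle G'$ denotes the symmetric difference $E(G)\triangle E(G')$ of the edge sets. An alternating cycle of $G$ is a cycle of vertex pairs from $V\times U$ whose pairs are alternately in $E(G)$ and not in $E(G)$. A $j$-swap of $G$ is the operation that takes an alternating cycle of $G$ of length $j$ with no repeated vertex, deletes from $G$ its pairs lying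 in $E(G)$, and adds its pairs not lying in $E(G)$. "$G_i\triangle G_{i+1}$ corresponds to a $j$-swap of $G_i$" means that $G_i\triangle G_{i+1}$ is the set of pairs of such an alternating cycle of $G_i$ of length $j$. *)

theory Defs
  imports Complex_Main
begin

text \<open>A bipartite graph on disjoint parts \<open>V\<close>, \<open>U\<close> is given by its edge set, a set of
  unordered pairs; the parts themselves are given by lists of their (labelled) vertices.\<close>

definition vertex_pairs :: "'a set \<Rightarrow> 'a set \<Rightarrow> 'a set set" where
  "vertex_pairs V U = {{x, y} | x y. x \<in> V \<and> y \<in> U}"

definition degree :: "'a set set \<Rightarrow> 'a \<Rightarrow> nat" where
  "degree E x = card {e \<in> E. x \<in> e}"

text \<open>The pairs \<open>{x\<^sub>0,x\<^sub>1}, \<dots>, {x\<^sub>m\<^sub>-\<^sub>1,x\<^sub>0}\<close> traversed by the closed walk through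
  \<open>[x\<^sub>0, \<dots>, x\<^sub>m\<^sub>-\<^sub>1]\<close>, in cyclic order.\<close>

definition cycle_pairs :: "'a list \<Rightarrow> 'a set list" where
  "cycle_pairs p = map (\<lambda>(x, y). {x, y}) (zip p (rotate1 p))"

definition is_forest :: "'a set set \<Rightarrow> bool" where
  "is_forest F \<longleftrightarrow> \<not> (\<exists>p. 3 \<le> length p \<and> distinct p \<and> set (cycle_pairs p) \<subseteq> F)"

text \<open>\<open>F\<^sub>E\<close> are the fixed edges, \<open>F\<^sub>N\<close> the fixed non-edges.\<close>

definition fixed_realisation ::
  "'a list \<Rightarrow> 'a list \<Rightarrow> nat list \<Rightarrow> nat list \<Rightarrow> 'a set set \<Rightarrow> 'a set set \<Rightarrow> 'a set set \<Rightarrow> bool" where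
  "fixed_realisation v u a b F\<^sub>E F\<^sub>N E \<longleftrightarrow>
     E \<subseteq> vertex_pairs (set v) (set u) \<and>
     (\<forall>i<length v. degree E (v ! i) = a ! i) \<and>
     (\<forall>j<length u. degree E (u ! j) = b ! j) \<and>
     F\<^sub>E \<subseteq> E \<and> F\<^sub>N \<inter> E = {}"

text \<open>An alternating cycle may revisit vertices but not pairs; swaps add the requirement that
  no vertex is repeated.\<close>

definition alternating_cycle :: "'a set \<Rightarrow> 'a set \<Rightarrow> 'a set set \<Rightarrow> 'a list \<Rightarrow> bool" where
  "alternating_cycle V U E p \<longleftrightarrow>
     3 \<le> length p \<and> distinct (cycle_pairs p) \<and>
     set (cycle_pairs p) \<subseteq> vertex_pairs V U \<and>
     (\<forall>i<length p. cycle_pairs p ! i \<in> E \<longleftrightarrow> cycle_pairs p ! (Suc i mod length p) \<notin> E)"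

text \<open>\<open>D\<close> is the set of pairs flipped by some \<open>j\<close>-swap of the graph with edge set \<open>E\<close>.\<close>

definition corresponds_to_swap ::
  "'a set \<Rightarrow> 'a set \<Rightarrow> nat \<Rightarrow> 'a set set \<Rightarrow> 'a set set \<Rightarrow> bool" where
  "corresponds_to_swap V U j E D \<longleftrightarrow>
     (\<exists>p. alternating_cycle V U E p \<and> distinct p \<and> length p = j \<and> D = set (cycle_pairs p))"

end

theory Submission
  imports Defs "HOL-Computational_Algebra.Primes"
begin

text \<open>Colour the pairs of \<open>E - E'\<close> red and those of \<open>E' - E\<close> blue. Equal degrees give a closed walk
  alternating between the colours; a shortest one is a cycle \<open>c\<^sub>0, \<dots>, c\<^sub>n\<^sub>-\<^sub>1\<close> whose chords are
  uncoloured. If \<open>n \<le> 6\<close>, swap along it. If \<open>n \<ge> 8\<close>, the chords \<open>{c\<^sub>i, c\<^sub>i\<^sub>+\<^sub>3}\<close> contain a cycle, so one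
  of them is not fixed; together with the three pairs it spans, it is a \<open>4\<close>-swap of \<open>E\<close> or of \<open>E'\<close>.
  In each case the symmetric difference loses at least two pairs. As swaps are reversible, one may
  work from both ends, and the last swap removes at least four pairs.\<close>

section \<open>Closed walks alternating between two colours\<close>

text \<open>The vertices are indexed by all naturals with period \<open>n\<close>, so that rotating
  a tour is a plain index shift. Vertices and pairs may repeat.\<close>

definition alternating_tour :: "'a set set \<Rightarrow> 'a set set \<Rightarrow> nat \<Rightarrow> (nat \<Rightarrow> 'a) \<Rightarrow> bool" where
  "alternating_tour R B n c \<longleftrightarrow> 0 < n \<and> even n \<and> (\<forall>i. c (i + n) = c i) \<and>
     (\<forall>i. {c i, c (Suc i)} \<in> (if even i then R else B))"

lemma alternating_tour_close:
  assumes "0 < n" "even n" "c n = c 0"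
    and step: "\<And>i. i < n \<Longrightarrow> {c i, c (Suc i)} \<in> (if even i then R else B)"
  shows "alternating_tour R B n (\<lambda>i. c (i mod n))"
proof -
  have "{c (i mod n), c (Suc i mod n)} \<in> (if even i then R else B)" for i
  proof -
    have "c (Suc i mod n) = c (Suc (i mod n))"
      using assms(1,3) by (simp add: mod_Suc)
    moreover have "even (i mod n) = even i"
      using assms(2) by (simp add: dvd_mod_iff)
    ultimately show ?thesis using step[of "i mod n"] assms(1) by simp
  qed
  then show ?thesis using assms(1,2) by (simp add: alternating_tour_def)
qed

text \<open>Rotation by an odd amount exchanges the two colours. This lets a statement about the
  start of a tour be transferred to any position.\<close>

lemma alternating_tour_shift:
  assumes "alternating_tour R B n c"
  shows "alternating_tour (if even k then R else B) (if even k then B else R) n (\<lambda>i. c (i + k))"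
proof -
  have "c (i + n + k) = c (i + k)" for i
  proof -
    have "c (i + k + n) = c (i + k)" using assms by (simp add: alternating_tour_def)
    then show ?thesis by (simp add: ac_simps)
  qed
  moreover have "{c (i + k), c (Suc i + k)} \<in> (if even (i + k) then R else B)" for i
    using assms unfolding alternating_tour_def by (metis add_Suc)
  then have "{c (i + k), c (Suc i + k)} \<in>
      (if even i then if even k then R else B else if even k then B else R)" for i
    by (metis even_add)
  ultimately show ?thesis using assms by (simp add: alternating_tour_def)
qed

text \<open>The stretch between two visits to one vertex closes up, and its even length makes the
  colours alternate at the joint too. The walk is not assumed periodic, so this serves both to find
  a first tour and to shorten a given one.\<close>

lemma alternating_tour_segment:
  assumes "i < j" "even (j - i)" "c i = c j"
    and step: "\<And>k. {c k, c (Suc k)} \<in> (if even k then R else B)"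
  shows "\<exists>d. alternating_tour (if even i then R else B) (if even i then B else R) (j - i) d"
proof -
  have "{c (t + i), c (Suc t + i)} \<in>
      (if even t then if even i then R else B else if even i then B else R)" for t
    using step[of "t + i"] by (simp split: if_splits)
  then have "alternating_tour (if even i then R else B) (if even i then B else R) (j - i)
      (\<lambda>t. c (t mod (j - i) + i))"
    using assms(1-3) by (intro alternating_tour_close[where c = "\<lambda>t. c (t + i)"]) simp_all
  then show ?thesis by blast
qed

lemma alternating_tour_mod:
  assumes "alternating_tour R B n c"
  shows "c (i mod n) = c i"
proof -
  have "c (j + n * q) = c j" for j q
  proof (induction q)
    case (Suc q)
    have "c (j + n * q + n) = c (j + n * q)" using assms by (simp add: alternating_tour_def)
    then show ?case using Suc by (simp add: ac_simps)
  qed simp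
  then show ?thesis by (metis mod_mult_div_eq)
qed

lemma finite_vertex_pairs: "finite V \<Longrightarrow> finite U \<Longrightarrow> finite (vertex_pairs V U)"
proof -
  assume "finite V" "finite U"
  moreover have "vertex_pairs V U = (\<lambda>(x, y). {x, y}) ` (V \<times> U)"
    by (auto simp: vertex_pairs_def)
  ultimately show ?thesis by simp
qed

text \<open>Every step changes sides, so the parity of the index determines the side. Hence a walk
  can return to a vertex only after an even number of steps.\<close>

lemma vertex_pairs_parity:
  assumes "V \<inter> U = {}" and "\<And>i. {c i, c (Suc i)} \<in> vertex_pairs V U"
  shows "c i \<in> V \<longleftrightarrow> (c 0 \<in> V \<longleftrightarrow> even (i :: nat))"
proof (induction i)
  case (Suc i)
  have "c i \<in> V \<longleftrightarrow> c (Suc i) \<notin> V"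
    using assms(1) assms(2)[of i] by (auto simp: vertex_pairs_def doubleton_eq_iff)
  then show ?case using Suc by auto
qed simp

lemma vertex_pairs_same_parity:
  assumes "V \<inter> U = {}" and "\<And>i. {c i, c (Suc i)} \<in> vertex_pairs V U"
    and "c i = c j"
  shows "even i = even (j :: nat)"
  using vertex_pairs_parity[of V U c i, OF assms(1,2)] vertex_pairs_parity[of V U c j, OF assms(1,2)]
    assms(3) by auto

text \<open>By equality of degrees, a vertex entered by one colour can be left by the other, so an
  alternating walk never gets stuck. Finiteness forces a repeated vertex, and bipartiteness makes
  the enclosed stretch even.\<close>

lemma ex_alternating_tour:
  assumes VU: "V \<inter> U = {}" and sub: "R \<union> B \<subseteq> vertex_pairs V U" and fin: "finite (R \<union> B)"
    and deg: "\<And>x. degree R x = degree B x" and "R \<noteq> {}"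
  shows "\<exists>n c. alternating_tour R B n c"
proof -
  have pos: "degree A x > 0 \<longleftrightarrow> x \<in> \<Union>A" if "finite A" for A :: "'a set set" and x
    using that by (auto simp: degree_def card_gt_0_iff)
  have W: "\<Union>R = \<Union>B"
  proof (rule set_eqI)
    fix x
    have "x \<in> \<Union>R \<longleftrightarrow> degree R x > 0" using pos fin by simp
    also have "\<dots> \<longleftrightarrow> x \<in> \<Union>B" unfolding deg using pos fin by simp
    finally show "x \<in> \<Union>R \<longleftrightarrow> x \<in> \<Union>B" .
  qed
  have nb: "\<exists>y. y \<in> \<Union>A \<and> {x, y} \<in> A" if x: "x \<in> \<Union>A" and A: "A \<subseteq> vertex_pairs V U" for A x
  proof -
    obtain e where e: "x \<in> e" "e \<in> A" using x by blast
    then obtain v u where "e = {v, u}" using A unfolding vertex_pairs_def by blast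
    then have "e = {x, v} \<or> e = {x, u}" using e(1) by auto
    then show ?thesis using e(2) by blast
  qed
  have ne: "\<exists>x. x \<in> \<Union>R"
  proof -
    obtain e where "e \<in> R" using \<open>R \<noteq> {}\<close> by blast
    moreover from this have "e \<in> vertex_pairs V U" using sub by blast
    then have "e \<noteq> {}" unfolding vertex_pairs_def by blast
    ultimately show ?thesis by blast
  qed
  have "\<exists>y. y \<in> \<Union>R \<and> {x, y} \<in> (if even n then R else B)" if "x \<in> \<Union>R" for x and n :: nat
  proof (cases "even n")
    case True
    then show ?thesis using nb[of x R] that sub by simp
  next
    case False
    then show ?thesis using nb[of x B] that sub unfolding W by simp
  qed
  then obtain c where c: "\<And>n. c n \<in> \<Union>R" "\<And>n. {c n, c (Suc n)} \<in> (if even n then R else B)"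
    using dependent_nat_choice[where P = "\<lambda>_ x. x \<in> \<Union>R"
        and Q = "\<lambda>n x y. {x, y} \<in> (if even n then R else B)"] ne by metis
  have "finite (\<Union>R)"
    using fin sub by (intro finite_Union) (auto simp: vertex_pairs_def)
  moreover have "range c \<subseteq> \<Union>R" using c(1) by (rule image_subsetI)
  ultimately have "\<not> inj c"
    using finite_subset finite_imageD infinite_UNIV_nat by metis
  then obtain i j where ij: "i < j" "c i = c j" by (metis injI linorder_neqE_nat)
  have vp: "{c i, c (Suc i)} \<in> vertex_pairs V U" for i
    using c(2)[of i] sub by (auto split: if_splits)
  have ev: "even (j - i)"
    using vertex_pairs_same_parity[OF VU vp ij(2)] ij(1) by simp
  obtain d where
    "alternating_tour (if even i then R else B) (if even i then B else R) (j - i) d"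
    using alternating_tour_segment[where c = c and R = R and B = B, OF ij(1) ev ij(2) c(2)] by blast
  \<comment> \<open>For odd \<open>i\<close> the tour found starts with \<open>B\<close>; an odd
    rotation makes it start with \<open>R\<close>.\<close>
  from alternating_tour_shift[OF this, of i] show ?thesis by (auto split: if_splits)
qed

section \<open>Shortest tours and their chords\<close>

locale shortest_tour =
  fixes V U :: "'a set" and R B n c
  assumes VU: "V \<inter> U = {}" and sub: "R \<subseteq> vertex_pairs V U" "B \<subseteq> vertex_pairs V U"
    and disj: "R \<inter> B = {}"
    and tour: "alternating_tour R B n c"
    and shortest: "\<And>m d. alternating_tour R B m d \<Longrightarrow> n \<le> m"
begin

lemma shortest': "alternating_tour B R m d \<Longrightarrow> n \<le> m"
  using alternating_tour_shift[of B R m d 1] shortest by simp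

text \<open>Minimality survives rotation, even when the colours trade places. Facts about the chord
  \<open>{c 0, c 3}\<close> therefore hold for every chord \<open>{c i, c (i + 3)}\<close>.\<close>

lemma shift: "shortest_tour V U (if even k then R else B) (if even k then B else R) n (\<lambda>i. c (i + k))"
proof (cases "even k")
  case True
  then show ?thesis
    using VU sub disj shortest alternating_tour_shift[OF tour, of k] by unfold_locales auto
next
  case False
  then show ?thesis
    using VU sub disj shortest' alternating_tour_shift[OF tour, of k] by unfold_locales auto
qed

lemma step: "{c i, c (Suc i)} \<in> (if even i then R else B)"
  using tour by (simp add: alternating_tour_def)

lemma step_vertex_pairs: "{c i, c (Suc i)} \<in> vertex_pairs V U"
  using step[of i] sub by (auto split: if_splits)

lemma even_n: "even n" and n_pos: "0 < n" and periodic: "c (i + n) = c i"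
  using tour by (simp_all add: alternating_tour_def)

text \<open>A tour of length 2 would run back along its own pair, which would then have both
  colours.\<close>

lemma ge_4: "4 \<le> n"
proof (rule ccontr)
  assume "\<not> 4 \<le> n"
  then have "n = 2" using even_n n_pos by presburger
  then show False
    using step[of 0] step[of 1] periodic[of 0] disj by (auto simp: numeral_2_eq_2 insert_commute)
qed

text \<open>A vertex repeated within one period would cut off a strictly shorter tour.\<close>

lemma inj: "inj_on c {..<n}"
proof -
  have False if "i < j" "j < n" "c i = c j" for i j
  proof -
    have "even (j - i)"
      using vertex_pairs_same_parity[OF VU step_vertex_pairs that(3)] that(1) by simp
    from alternating_tour_segment[of i j c R B, OF that(1) this that(3) step] obtain d where
      "alternating_tour (if even i then R else B) (if even i then B else R) (j - i) d"
      by blast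
    then have "n \<le> j - i" using shortest shortest' by (auto split: if_splits)
    then show False using that by simp
  qed
  then show ?thesis by (metis inj_onI lessThan_iff linorder_neqE_nat)
qed

lemma eq_iff: "i < n \<Longrightarrow> j < n \<Longrightarrow> c i = c j \<longleftrightarrow> i = j"
  using inj by (simp add: inj_on_eq_iff)

lemma chord_vertex_pairs: "{c 0, c 3} \<in> vertex_pairs V U"
  using VU step_vertex_pairs[of 0] step_vertex_pairs[of 1] step_vertex_pairs[of 2]
  by (fastforce simp: vertex_pairs_def doubleton_eq_iff numeral_2_eq_2 numeral_3_eq_3)

text \<open>Either colour on the chord would close a shorter tour on one of its two sides.\<close>

lemma chord_uncoloured:
  assumes "4 < n"
  shows "{c 0, c 3} \<notin> R \<union> B"
proof
  assume "{c 0, c 3} \<in> R \<union> B"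
  then consider "{c 0, c 3} \<in> B" | "{c 0, c 3} \<in> R" by blast
  then show False
  proof cases
    case 1
    \<comment> \<open>Three steps along the tour, then back by the chord. The chord is step 3, an
      odd one, so blue is the colour that fits.\<close>
    define d where "d = c(4 := c 0)"
    have "{d i, d (Suc i)} \<in> (if even i then R else B)" if "i < 4" for i
    proof -
      have "i = 0 \<or> i = 1 \<or> i = 2 \<or> i = 3" using that by presburger
      then show ?thesis using 1 step[of i] by (auto simp: d_def insert_commute)
    qed
    then have "alternating_tour R B 4 (\<lambda>i. d (i mod 4))"
      by (intro alternating_tour_close) (auto simp: d_def)
    then show False using shortest assms by fastforce
  next
    case 2
    \<comment> \<open>The chord replaces the first three steps. It becomes step 0, which must be
      red, and the shift by 2 keeps the parity of all later steps.\<close>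
    define d where "d i = (if i = 0 then c 0 else c (i + 2))" for i
    have "{d i, d (Suc i)} \<in> (if even i then R else B)" for i
      using 2 step[of "i + 2"] by (cases "i = 0") (simp_all add: d_def numeral_3_eq_3)
    moreover have "d (n - 2) = d 0" using periodic[of 0] assms by (simp add: d_def del: add_2_eq_Suc')
    ultimately have "alternating_tour R B (n - 2) (\<lambda>i. d (i mod (n - 2)))"
      using even_n assms by (intro alternating_tour_close) auto
    then show False using shortest assms by fastforce
  qed
qed

end

section \<open>Cyclic lists: cycles of fixed pairs, and swaps\<close>

lemma nth_cycle_pairs:
  assumes "i < length p"
  shows "cycle_pairs p ! i = {p ! i, p ! (Suc i mod length p)}"
  using assms by (simp add: cycle_pairs_def nth_rotate1)

lemma length_cycle_pairs [simp]: "length (cycle_pairs p) = length p"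
  by (simp add: cycle_pairs_def)

text \<open>The steps of length \<open>3\<close> around a cycle of length \<open>n \<ge> 8\<close> form cycles of length
  \<open>n\<close>, or of length \<open>n / 3\<close> if \<open>n\<close> is divisible by \<open>3\<close>.\<close>

lemma not_forest_step3:
  fixes n :: nat
  assumes "8 \<le> n" and inj: "inj_on c {..<n}"
    and F: "\<And>i. {c (i mod n), c ((i + 3) mod n)} \<in> F"
  shows "\<not> is_forest F"
proof -
  \<comment> \<open>\<open>m\<close> is the additive order of 3 modulo \<open>n\<close>. It is at
    least 3, since a multiple of 3 that is at least 8 is at least 9.\<close>
  define m where "m = (if 3 dvd n then n div 3 else n)"
  define p where "p = map (\<lambda>t. c (3 * t mod n)) [0..<m]"
  have m3: "3 \<le> m" using assms(1) by (auto simp: m_def)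
  have dvd: "n dvd 3 * m" by (auto simp: m_def)
  have "{p ! i, p ! (Suc i mod m)} \<in> F" if "i < m" for i
  proof -
    \<comment> \<open>Because \<open>n\<close> divides \<open>3 * m\<close>, wrapping around in
      \<open>p\<close> is invisible modulo \<open>n\<close>; the closing pair is again a step of
      length 3.\<close>
    have "3 * (Suc i mod m) mod n = 3 * Suc i mod n"
      using dvd by (simp only: mult_mod_right mod_mod_cancel)
    then show ?thesis using F[of "3 * i"] that m3 by (simp add: p_def add.commute)
  qed
  then have "set (cycle_pairs p) \<subseteq> F"
    by (auto simp: in_set_conv_nth nth_cycle_pairs p_def simp del: upt_Suc)
  moreover have "distinct p"
  proof -
    have less: "s = t" if "s \<le> t" "t < m" and eq: "3 * s mod n = 3 * t mod n" for s t
    proof (cases "3 dvd n")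
      case True
      then show ?thesis using that by (auto simp: m_def)
    next
      case False
      \<comment> \<open>Here 3 is invertible modulo \<open>n\<close>, so \<open>n\<close> divides
        \<open>t - s\<close>, which is less than \<open>n\<close>.\<close>
      have "n dvd 3 * (t - s)"
        using eq that(1) by (metis diff_mult_distrib2 mod_eq_dvd_iff_nat mult_le_mono2)
      moreover have "coprime n 3"
        using False prime_imp_coprime_nat[of 3 n] by (simp add: coprime_commute)
      ultimately have "n dvd t - s" by (simp add: coprime_dvd_mult_right_iff)
      then show ?thesis using that(1,2) False by (auto simp: m_def dest: dvd_imp_le)
    qed
    have "inj_on (\<lambda>t. 3 * t mod n) {0..<m}"
    proof (rule linorder_inj_onI')
      fix s t assume "t \<in> {0..<m}" "s < t"
      then show "3 * s mod n \<noteq> 3 * t mod n" using less[of s t] by (metis atLeastLessThan_iff less_imp_le less_irrefl)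
    qed
    moreover have "inj_on c ((\<lambda>t. 3 * t mod n) ` {0..<m})"
      using assms(1) by (intro inj_on_subset[OF inj]) auto
    ultimately have "inj_on (c \<circ> (\<lambda>t. 3 * t mod n)) {0..<m}"
      by (rule comp_inj_on)
    then show ?thesis by (simp add: p_def distinct_map comp_def)
  qed
  moreover have "3 \<le> length p" using m3 by (simp add: p_def)
  ultimately show ?thesis unfolding is_forest_def by blast
qed

text \<open>At each vertex of the cycle one pair is lost and one gained. The count is done as a
  signed sum over the pairs of the cycle, which cancels after a cyclic reindexing.\<close>

lemma degree_alternating_cycle:
  assumes alt: "alternating_cycle V U E p" and "distinct p" and fin: "finite E"
  shows "degree (sym_diff E (set (cycle_pairs p))) x = degree E x"
proof -
  define n where "n = length p"
  define D where "D = set (cycle_pairs p)"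
  define g where "g i = cycle_pairs p ! i" for i
  \<comment> \<open>Deleted pairs get sign 1 and added pairs sign -1, so the sum of
    \<open>s e\<close> over the pairs \<open>e\<close> of \<open>D\<close> containing
    \<open>x\<close> is the degree that \<open>x\<close> loses.\<close>
  define s :: "'a set \<Rightarrow> int" where "s e = (if e \<in> E then 1 else - 1)" for e
  define y :: "nat \<Rightarrow> int" where "y i = of_bool (x = p ! i)" for i
  have sg: "s (g (Suc i mod n)) = - s (g i)" if "i < n" for i
    using alt that by (auto simp: alternating_cycle_def n_def g_def s_def)
  have n: "3 \<le> n" and dist: "distinct (cycle_pairs p)"
    using alt by (auto simp: alternating_cycle_def n_def)
  have bij: "bij_betw (\<lambda>i. Suc i mod n) {..<n} {..<n}"
  proof (intro bij_betwI')
    fix i j assume "i \<in> {..<n}" "j \<in> {..<n}"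
    then show "Suc i mod n = Suc j mod n \<longleftrightarrow> i = j" by (auto simp: mod_Suc split: if_splits)
  next
    fix j assume "j \<in> {..<n}"
    then show "\<exists>i\<in>{..<n}. j = Suc i mod n"
      by (intro bexI[of _ "if j = 0 then n - 1 else j - 1"]) auto
  qed (use n in auto)
  have D: "bij_betw g {..<n} D"
    using bij_betw_nth[OF dist, of "{..<n}" D] by (simp add: n_def D_def g_def[abs_def])
  \<comment> \<open>The two ends of a pair differ, so the contributions of the ends add up to at
    most 1.\<close>
  have mem: "of_bool (x \<in> g i) = y i + y (Suc i mod n)" if "i < n" for i
  proof -
    have "i \<noteq> Suc i mod n" using n that by (auto simp: mod_Suc)
    moreover have "Suc i mod n < n" using n by simp
    ultimately have "p ! i \<noteq> p ! (Suc i mod n)"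
      using that n \<open>distinct p\<close> nth_eq_iff_index_eq[of p i "Suc i mod n"] by (simp add: n_def)
    then show ?thesis using that by (auto simp: g_def y_def nth_cycle_pairs n_def)
  qed
  have "(\<Sum>e\<in>D. s e * of_bool (x \<in> e)) = (\<Sum>i<n. s (g i) * of_bool (x \<in> g i))"
    by (rule sum.reindex_bij_betw[OF D, symmetric])
  \<comment> \<open>The sign flips from each pair to the next, so the share of the second endpoints
    is the negative of the first sum, shifted cyclically by one.\<close>
  also have "\<dots> = (\<Sum>i<n. s (g i) * y i) - (\<Sum>i<n. s (g (Suc i mod n)) * y (Suc i mod n))"
    by (simp add: mem sg distrib_left sum.distrib sum_negf)
  also have "\<dots> = 0" using sum.reindex_bij_betw[OF bij, of "\<lambda>i. s (g i) * y i"] by simp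
  finally have sum0: "(\<Sum>e\<in>D. s e * of_bool (x \<in> e)) = 0" .
  have finD: "finite D" by (simp add: D_def)
  have deg: "int (degree A x) = (\<Sum>e\<in>E \<union> D. of_bool (e \<in> A \<and> x \<in> e))" if "A \<subseteq> E \<union> D" for A
  proof -
    have "(E \<union> D) \<inter> {e. e \<in> A \<and> x \<in> e} = {e \<in> A. x \<in> e}" using that by blast
    then show ?thesis using fin finD by (simp add: degree_def)
  qed
  have "int (degree (sym_diff E D) x) - int (degree E x) =
      (\<Sum>e\<in>E \<union> D. of_bool (e \<in> sym_diff E D \<and> x \<in> e) - of_bool (e \<in> E \<and> x \<in> e))"
    using deg[of "sym_diff E D"] deg[of E] unfolding sum_subtractf by auto
  also have "\<dots> = (\<Sum>e\<in>D. of_bool (e \<in> sym_diff E D \<and> x \<in> e) - of_bool (e \<in> E \<and> x \<in> e))"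
    using fin finD by (intro sum.mono_neutral_right) auto
  also have "\<dots> = (\<Sum>e\<in>D. - (s e * of_bool (x \<in> e)))"
    by (intro sum.cong) (auto simp: s_def)
  also have "\<dots> = 0" using sum0 by (simp add: sum_negf)
  finally show ?thesis by (simp add: D_def)
qed

lemma fixed_realisation_swap:
  assumes "corresponds_to_swap (set v) (set u) j E D" and "D \<inter> (F\<^sub>E \<union> F\<^sub>N) = {}"
    and "fixed_realisation v u a b F\<^sub>E F\<^sub>N E"
  shows "fixed_realisation v u a b F\<^sub>E F\<^sub>N (sym_diff E D)"
proof -
  have "finite E"
    using assms(3) finite_vertex_pairs[of "set v" "set u"]
    by (auto simp: fixed_realisation_def intro: finite_subset)
  moreover obtain p where p: "alternating_cycle (set v) (set u) E p" "distinct p"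
      "D = set (cycle_pairs p)"
    using assms(1) by (auto simp: corresponds_to_swap_def)
  ultimately have "degree (sym_diff E D) x = degree E x" for x
    using degree_alternating_cycle by metis
  moreover have "D \<subseteq> vertex_pairs (set v) (set u)"
    using p by (simp add: alternating_cycle_def)
  ultimately show ?thesis using assms(2,3) by (auto simp: fixed_realisation_def)
qed

text \<open>Flipping every pair of \<open>D\<close> preserves the alternation along the cycle, so
  the same list undoes the swap.\<close>

lemma corresponds_to_swap_sym:
  assumes "corresponds_to_swap V U j E D"
  shows "corresponds_to_swap V U j (sym_diff E D) D"
proof -
  obtain p where p: "alternating_cycle V U E p" "distinct p" "length p = j" "D = set (cycle_pairs p)"
    using assms by (auto simp: corresponds_to_swap_def)
  have flip: "cycle_pairs p ! i \<in> sym_diff E D \<longleftrightarrow> cycle_pairs p ! i \<notin> E" if "i < length p" for i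
    using that unfolding p(4) by auto
  have "cycle_pairs p ! i \<in> sym_diff E D \<longleftrightarrow> cycle_pairs p ! (Suc i mod length p) \<notin> sym_diff E D"
    if "i < length p" for i
  proof -
    have "Suc i mod length p < length p" using that by (intro mod_less_divisor) auto
    then show ?thesis
      using p(1) that unfolding flip[OF that] alternating_cycle_def by (subst flip) auto
  qed
  then have "alternating_cycle V U (sym_diff E D) p"
    using p(1) unfolding alternating_cycle_def by blast
  then show ?thesis using p by (auto simp: corresponds_to_swap_def)
qed

lemma card_corresponds_to_swap: "corresponds_to_swap V U j E D \<Longrightarrow> card D = j"
  by (auto simp: corresponds_to_swap_def alternating_cycle_def distinct_card)

lemma corresponds_to_swap4:
  assumes "distinct [x, y, z, w]" and "{{x, y}, {y, z}, {z, w}, {w, x}} \<subseteq> vertex_pairs V U"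
    and "{x, y} \<in> E" "{y, z} \<notin> E" "{z, w} \<in> E" "{w, x} \<notin> E"
  shows "corresponds_to_swap V U 4 E {{x, y}, {y, z}, {z, w}, {w, x}}"
proof -
  let ?p = "[x, y, z, w]"
  have cp: "cycle_pairs ?p = [{x, y}, {y, z}, {z, w}, {w, x}]" by (simp add: cycle_pairs_def)
  have alt: "cycle_pairs ?p ! i \<in> E \<longleftrightarrow> cycle_pairs ?p ! (Suc i mod length ?p) \<notin> E"
    if "i < length ?p" for i
  proof -
    have "i = 0 \<or> i = 1 \<or> i = 2 \<or> i = 3"
      using that by auto
    then show ?thesis unfolding cp using assms(3-) by (elim disjE) simp_all
  qed
  \<comment> \<open>Distinctness of the reversed list supplies each inequality in the other
    orientation, as comparing unordered pairs requires.\<close>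
  have dist: "distinct (cycle_pairs ?p)"
    unfolding cp using assms(1) assms(1)[folded distinct_rev[of ?p]] by (simp add: doubleton_eq_iff)
  have vp: "set (cycle_pairs ?p) \<subseteq> vertex_pairs V U"
    unfolding cp using assms(2) by simp
  have "3 \<le> length ?p" by simp
  then have "alternating_cycle V U E ?p"
    unfolding alternating_cycle_def using alt dist vp by blast
  moreover have "{{x, y}, {y, z}, {z, w}, {w, x}} = set (cycle_pairs ?p)" unfolding cp by simp
  moreover have "length ?p = 4" by simp
  ultimately show ?thesis
    using assms(1) unfolding corresponds_to_swap_def by (intro exI[of _ ?p] conjI)
qed

lemma corresponds_to_swap6:
  assumes "distinct [x, y, z, w, s, t]"
    and "{{x, y}, {y, z}, {z, w}, {w, s}, {s, t}, {t, x}} \<subseteq> vertex_pairs V U"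
    and "{x, y} \<in> E" "{y, z} \<notin> E" "{z, w} \<in> E" "{w, s} \<notin> E" "{s, t} \<in> E" "{t, x} \<notin> E"
  shows "corresponds_to_swap V U 6 E {{x, y}, {y, z}, {z, w}, {w, s}, {s, t}, {t, x}}"
proof -
  let ?p = "[x, y, z, w, s, t]"
  have cp: "cycle_pairs ?p = [{x, y}, {y, z}, {z, w}, {w, s}, {s, t}, {t, x}]" by (simp add: cycle_pairs_def)
  have alt: "cycle_pairs ?p ! i \<in> E \<longleftrightarrow> cycle_pairs ?p ! (Suc i mod length ?p) \<notin> E"
    if "i < length ?p" for i
  proof -
    have "i = 0 \<or> i = 1 \<or> i = 2 \<or> i = 3 \<or> i = 4 \<or> i = 5"
      using that by auto
    then show ?thesis unfolding cp using assms(3-) by (elim disjE) simp_all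
  qed
  have dist: "distinct (cycle_pairs ?p)"
    unfolding cp using assms(1) assms(1)[folded distinct_rev[of ?p]] by (simp add: doubleton_eq_iff)
  have vp: "set (cycle_pairs ?p) \<subseteq> vertex_pairs V U"
    unfolding cp using assms(2) by simp
  have "3 \<le> length ?p" by simp
  then have "alternating_cycle V U E ?p"
    unfolding alternating_cycle_def using alt dist vp by blast
  moreover have "{{x, y}, {y, z}, {z, w}, {w, s}, {s, t}, {t, x}} = set (cycle_pairs ?p)" unfolding cp by simp
  moreover have "length ?p = 6" by simp
  ultimately show ?thesis
    using assms(1) unfolding corresponds_to_swap_def by (intro exI[of _ ?p] conjI)
qed

section \<open>Swaps that shrink the symmetric difference\<close>

definition swap46 :: "'a set \<Rightarrow> 'a set \<Rightarrow> 'a set set \<Rightarrow> 'a set set \<Rightarrow> bool" where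
  "swap46 V U E D \<longleftrightarrow> corresponds_to_swap V U 4 E D \<or> corresponds_to_swap V U 6 E D"

text \<open>A free chord closing three consecutive pairs of the tour gives a \<open>4\<close>-swap in \<open>E\<close> if it
  is a non-edge of both graphs, and in \<open>E'\<close> if it is an edge of both.\<close>

lemma chord_swap:
  assumes "shortest_tour V U (E - E') (E' - E) n c" and "8 \<le> n"
    and free: "{c 0, c 3} \<notin> F" and F: "F \<inter> sym_diff E E' = {}" and fin: "finite (sym_diff E E')"
  shows "\<exists>D. D \<inter> F = {} \<and> card (sym_diff (sym_diff E E') D) + 2 \<le> card (sym_diff E E') \<and>
    (swap46 V U E D \<or> swap46 V U E' D)"
proof -
  interpret shortest_tour V U "E - E'" "E' - E" n c by fact
  have s: "{c 0, c 1} \<in> E - E'" "{c 1, c 2} \<in> E' - E" "{c 2, c 3} \<in> E - E'"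
    using step[of 0] step[of 1] step[of 2] by (simp_all add: numeral_2_eq_2 numeral_3_eq_3)
  have ch: "{c 3, c 0} \<notin> sym_diff E E'"
    using chord_uncoloured assms(2) by (simp add: insert_commute)
  have dist: "distinct [c 0, c 1, c 2, c 3]" using assms(2) by (simp add: eq_iff)
  have vp: "{{c 0, c 1}, {c 1, c 2}, {c 2, c 3}, {c 3, c 0}} \<subseteq> vertex_pairs V U"
    using s sub chord_vertex_pairs by (auto simp: insert_commute)
  define T where "T = {{c 0, c 1}, {c 1, c 2}, {c 2, c 3}}"
  define D where "D = {{c 0, c 1}, {c 1, c 2}, {c 2, c 3}, {c 3, c 0}}"
  \<comment> \<open>Three coloured pairs leave the difference and the uncoloured chord enters it: a
    net loss of two.\<close>
  have D: "sym_diff (sym_diff E E') D = insert {c 3, c 0} (sym_diff E E' - T)"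
    using s ch by (auto simp: D_def T_def)
  have "T \<subseteq> sym_diff E E'" using s by (auto simp: T_def)
  moreover have "card T = 3" using dist by (simp add: T_def doubleton_eq_iff)
  ultimately have "card (sym_diff E E') = card (sym_diff E E' - T) + 3"
    using fin by (metis card_Diff_subset card_mono finite_subset le_add_diff_inverse2)
  then have "card (sym_diff (sym_diff E E') D) + 2 \<le> card (sym_diff E E')"
    using fin ch unfolding D by simp
  moreover have "D \<inter> F = {}" using s free F by (auto simp: D_def insert_commute)
  moreover have "swap46 V U E D \<or> swap46 V U E' D"
  proof (cases "{c 3, c 0} \<in> E")
    case False
    then show ?thesis
      using corresponds_to_swap4[OF dist vp] s unfolding swap46_def D_def by blast
  next
    case True
    \<comment> \<open>\<open>E'\<close> contains \<open>{c 1, c 2}\<close> and, the chord being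
      uncoloured, \<open>{c 3, c 0}\<close>. The list starts at \<open>c 1\<close> so that its first
      pair is an edge.\<close>
    have "corresponds_to_swap V U 4 E' {{c 1, c 2}, {c 2, c 3}, {c 3, c 0}, {c 0, c 1}}"
      using True ch s dist vp by (intro corresponds_to_swap4) auto
    moreover have "{{c 1, c 2}, {c 2, c 3}, {c 3, c 0}, {c 0, c 1}} = D" by (auto simp: D_def)
    ultimately show ?thesis by (simp add: swap46_def)
  qed
  ultimately show ?thesis by blast
qed

text \<open>A shortest tour of length 4 or 6 has no repeated vertex and is itself the cycle to swap.
  It consists of coloured pairs only, so every flip removes a pair from the difference.\<close>

lemma short_tour_swap:
  assumes "shortest_tour V U (E - E') (E' - E) n c" and "n < 8"
  shows "\<exists>D. D \<subseteq> sym_diff E E' \<and> swap46 V U E D"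
proof -
  interpret shortest_tour V U "E - E'" "E' - E" n c by fact
  have s: "{c i, c (Suc i)} \<in> sym_diff E E'" "{c i, c (Suc i)} \<in> E \<longleftrightarrow> even i" for i
    using step[of i] by (auto split: if_splits)
  have n: "n = 4 \<or> n = 6" using even_n ge_4 assms(2) by presburger
  then show ?thesis
  proof
    assume n: "n = 4"
    have c4: "c 4 = c 0" using periodic[of 0] n by simp
    have "corresponds_to_swap V U 4 E {{c 0, c 1}, {c 1, c 2}, {c 2, c 3}, {c 3, c 0}}"
      using s(2)[of 0] s(2)[of 1] s(2)[of 2] s(2)[of 3] c4 step_vertex_pairs[of 0]
        step_vertex_pairs[of 1] step_vertex_pairs[of 2] step_vertex_pairs[of 3]
      by (intro corresponds_to_swap4) (simp_all add: eq_iff n flip: One_nat_def)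
    moreover have "{{c 0, c 1}, {c 1, c 2}, {c 2, c 3}, {c 3, c 0}} \<subseteq> sym_diff E E'"
      using s(1)[of 0] s(1)[of 1] s(1)[of 2] s(1)[of 3] c4 by (simp flip: One_nat_def)
    ultimately show ?thesis unfolding swap46_def by blast
  next
    assume n: "n = 6"
    have c6: "c 6 = c 0" using periodic[of 0] n by simp
    have "corresponds_to_swap V U 6 E
        {{c 0, c 1}, {c 1, c 2}, {c 2, c 3}, {c 3, c 4}, {c 4, c 5}, {c 5, c 0}}"
      using s(2)[of 0] s(2)[of 1] s(2)[of 2] s(2)[of 3] s(2)[of 4] s(2)[of 5] c6
        step_vertex_pairs[of 0] step_vertex_pairs[of 1] step_vertex_pairs[of 2]
        step_vertex_pairs[of 3] step_vertex_pairs[of 4] step_vertex_pairs[of 5]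
      by (intro corresponds_to_swap6) (simp_all add: eq_iff n flip: One_nat_def)
    moreover have "{{c 0, c 1}, {c 1, c 2}, {c 2, c 3}, {c 3, c 4}, {c 4, c 5}, {c 5, c 0}}
        \<subseteq> sym_diff E E'"
      using s(1)[of 0] s(1)[of 1] s(1)[of 2] s(1)[of 3] s(1)[of 4] s(1)[of 5] c6
      by (simp flip: One_nat_def)
    ultimately show ?thesis unfolding swap46_def by blast
  qed
qed

text \<open>The disjunction is essential to the chord argument: whether the free chord is a common
  edge or a common non-edge decides which of the two graphs can be swapped.\<close>

lemma ex_reducing_swap:
  assumes VU: "V \<inter> U = {}" and sub: "E \<subseteq> vertex_pairs V U" "E' \<subseteq> vertex_pairs V U"
    and fin: "finite E" "finite E'" and deg: "\<And>x. degree E x = degree E' x" and "E \<noteq> E'"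
    and F: "F \<inter> sym_diff E E' = {}" and forest: "is_forest F"
  shows "\<exists>D. D \<inter> F = {} \<and> card (sym_diff (sym_diff E E') D) + 2 \<le> card (sym_diff E E') \<and>
    (swap46 V U E D \<or> swap46 V U E' D)"
proof -
  \<comment> \<open>The common pairs contribute equally to both degrees and cancel.\<close>
  have "degree (E - E') x = degree (E' - E) x" for x
  proof -
    have "degree A x = degree (A - B) x + degree (A \<inter> B) x" if "finite A" for A B :: "'a set set"
    proof -
      have "{e \<in> A. x \<in> e} = {e \<in> A - B. x \<in> e} \<union> {e \<in> A \<inter> B. x \<in> e}" by blast
      then show ?thesis unfolding degree_def using that by (simp add: card_Un_disjoint Int_def)
    qed
    from this[of E E'] this[of E' E] show ?thesis using fin deg[of x] by (simp add: Int_commute)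
  qed
  moreover have "E - E' \<noteq> {}"
  proof
    assume "E - E' = {}"
    then have "degree (E' - E) x = 0" for x
      using \<open>\<And>x. degree (E - E') x = degree (E' - E) x\<close>[of x]
      unfolding \<open>E - E' = {}\<close> by (simp add: degree_def)
    moreover obtain e where e: "e \<in> E' - E" using \<open>E \<noteq> E'\<close> \<open>E - E' = {}\<close> by blast
    moreover obtain x where "x \<in> e" using e sub by (auto simp: vertex_pairs_def)
    ultimately show False using fin by (auto simp: degree_def)
  qed
  ultimately have "\<exists>n c. alternating_tour (E - E') (E' - E) n c"
    using VU sub fin by (intro ex_alternating_tour) auto
  then obtain n where "\<exists>c. alternating_tour (E - E') (E' - E) n c"
    and least: "\<And>m. \<exists>c. alternating_tour (E - E') (E' - E) m c \<Longrightarrow> n \<le> m"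
    using exists_least_iff[of "\<lambda>n. \<exists>c. alternating_tour (E - E') (E' - E) n c"]
    by (metis not_less)
  then obtain c where c: "alternating_tour (E - E') (E' - E) n c" by blast
  then interpret shortest_tour V U "E - E'" "E' - E" n c
    using VU sub by unfold_locales (auto intro: least)
  show ?thesis
  proof (cases "n < 8")
    case True
    then obtain D where D: "D \<subseteq> sym_diff E E'" "swap46 V U E D"
      using short_tour_swap[OF shortest_tour_axioms] by blast
    have "card D \<ge> 4" using D(2) by (auto simp: swap46_def dest: card_corresponds_to_swap)
    moreover have "card (sym_diff E E') = card (sym_diff E E' - D) + card D"
    proof -
      have "finite (sym_diff E E')" using fin by simp
      moreover from this have "finite D" using D(1) finite_subset by blast
      ultimately show ?thesis
        using card_Diff_subset[of D "sym_diff E E'"] card_mono[of "sym_diff E E'" D] D(1) by linarith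
    qed
    moreover have "sym_diff (sym_diff E E') D = sym_diff E E' - D" using D(1) by blast
    ultimately show ?thesis using D F by (intro exI[of _ D]) auto
  next
    case False
    have "\<exists>i. {c (i mod n), c ((i + 3) mod n)} \<notin> F"
      using not_forest_step3[OF _ inj, of F] False forest by auto
    then obtain i where i: "{c i, c (i + 3)} \<notin> F"
      by (auto simp: alternating_tour_mod[OF tour])
    show ?thesis
    proof (cases "even i")
      case True
      then have "shortest_tour V U (E - E') (E' - E) n (\<lambda>t. c (t + i))" using shift[of i] by simp
      then show ?thesis
        using chord_swap[of V U E E' n "\<lambda>t. c (t + i)" F] False i F fin by (simp add: add.commute)
    next
      case odd: False
      \<comment> \<open>An odd rotation exchanges red and blue, so the chord argument applies with
        \<open>E\<close> and \<open>E'\<close> interchanged; its conclusion is symmetric in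
        them.\<close>
      then have "shortest_tour V U (E' - E) (E - E') n (\<lambda>t. c (t + i))" using shift[of i] by simp
      then show ?thesis
        using chord_swap[of V U E' E n "\<lambda>t. c (t + i)" F] False i F fin
        by (simp add: add.commute Un_commute disj_commute)
    qed
  qed
qed

section \<open>Joining swaps into a sequence\<close>

text \<open>Induction on the size of the difference: a swap in \<open>E\<close> is put in front of
  the remaining sequence, a swap in \<open>E'\<close> is reversed and put at its end. Since
  \<open>m\<close> swaps visit \<open>m + 1\<close> realisations, the bound counts
  \<open>m + 1\<close>.\<close>

lemma swap_sequence:
  assumes VU: "set v \<inter> set u = {}" and len: "length a = length v" "length b = length u"
    and forest: "is_forest (F\<^sub>E \<union> F\<^sub>N)"
    and "fixed_realisation v u a b F\<^sub>E F\<^sub>N E" "fixed_realisation v u a b F\<^sub>E F\<^sub>N E'" "E \<noteq> E'"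
  defines "S \<equiv> {(X, Y). swap46 (set v) (set u) X (sym_diff X Y) \<and>
     fixed_realisation v u a b F\<^sub>E F\<^sub>N X \<and> fixed_realisation v u a b F\<^sub>E F\<^sub>N Y}"
  shows "\<exists>m. (E, E') \<in> S ^^ m \<and> 2 * (m + 1) \<le> card (sym_diff E E')"
  using assms(5-7)
proof (induction "card (sym_diff E E')" arbitrary: E E' rule: less_induct)
  case less
  let ?V = "set v" and ?U = "set u" and ?real = "fixed_realisation v u a b F\<^sub>E F\<^sub>N"
  have sub: "E \<subseteq> vertex_pairs ?V ?U" "E' \<subseteq> vertex_pairs ?V ?U"
    using less.prems by (auto simp: fixed_realisation_def)
  then have fin: "finite E" "finite E'"
    using finite_vertex_pairs[of ?V ?U] by (auto intro: finite_subset)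
  \<comment> \<open>Vertices outside both parts lie on no pair and have degree 0 in both
    graphs.\<close>
  have deg: "degree E x = degree E' x" for x
  proof (cases "x \<in> ?V \<union> ?U")
    case True
    then show ?thesis using less.prems by (auto simp: fixed_realisation_def in_set_conv_nth)
  next
    case False
    then have "{e \<in> A. x \<in> e} = {}" if "A \<subseteq> vertex_pairs ?V ?U" for A
      using that by (fastforce simp: vertex_pairs_def)
    then show ?thesis using sub unfolding degree_def by metis
  qed
  have "(F\<^sub>E \<union> F\<^sub>N) \<inter> sym_diff E E' = {}"
    using less.prems by (auto simp: fixed_realisation_def)
  then obtain D where D: "D \<inter> (F\<^sub>E \<union> F\<^sub>N) = {}"
      "card (sym_diff (sym_diff E E') D) + 2 \<le> card (sym_diff E E')"
      "swap46 ?V ?U E D \<or> swap46 ?V ?U E' D"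
    using ex_reducing_swap[OF VU sub fin deg less.prems(3) _ forest] by blast
  have swapS: "(X, sym_diff X D) \<in> S" "(sym_diff X D, X) \<in> S" "card D \<ge> 4"
    if "swap46 ?V ?U X D" "?real X" for X
  proof -
    have r: "?real (sym_diff X D)"
      using that D(1) fixed_realisation_swap unfolding swap46_def by blast
    have "swap46 ?V ?U (sym_diff X D) D"
      using that(1) corresponds_to_swap_sym unfolding swap46_def by metis
    moreover have "sym_diff X (sym_diff X D) = D" "sym_diff (sym_diff X D) X = D" by blast+
    ultimately show "(X, sym_diff X D) \<in> S" "(sym_diff X D, X) \<in> S"
      using that r unfolding S_def by simp_all
    show "card D \<ge> 4" using that(1) by (auto simp: swap46_def dest: card_corresponds_to_swap)
  qed
  \<comment> \<open>The last swap pays for two realisations: it flips at least 4 pairs, which is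
    \<open>2 * (1 + 1)\<close>. This case stands apart because the bound fails for equal
    graphs.\<close>
  have one: "\<exists>m. (E, E') \<in> S ^^ m \<and> 2 * (m + 1) \<le> card (sym_diff E E')"
    if "(E, E') \<in> S"
  proof -
    have "card (sym_diff E E') \<ge> 4"
      using that by (auto simp: S_def swap46_def dest!: card_corresponds_to_swap)
    then show ?thesis using that by (intro exI[of _ 1]) auto
  qed
  from D(3) show ?case
  proof
    assume sw: "swap46 ?V ?U E D"
    define E1 where "E1 = sym_diff E D"
    have S: "(E, E1) \<in> S" using swapS sw less.prems(1) by (simp add: E1_def)
    have eq: "sym_diff E1 E' = sym_diff (sym_diff E E') D" by (auto simp: E1_def)
    show ?case
    proof (cases "E1 = E'")
      case True
      then show ?thesis using one S by simp
    next
      case False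
      then obtain m where m: "(E1, E') \<in> S ^^ m" "2 * (m + 1) \<le> card (sym_diff E1 E')"
        using less.hyps[of E1 E'] D(2) less.prems(2) S unfolding eq by (auto simp: S_def)
      have "(E, E') \<in> S ^^ Suc m" using S m(1) by (rule relpow_Suc_I2)
      then show ?thesis using m(2) D(2) unfolding eq by (intro exI[of _ "Suc m"]) simp
    qed
  next
    assume sw: "swap46 ?V ?U E' D"
    define E1 where "E1 = sym_diff E' D"
    \<comment> \<open>The swap was found going from \<open>E'\<close> to \<open>E1\<close>; the
      sequence uses its reverse.\<close>
    have S: "(E1, E') \<in> S" using swapS sw less.prems(2) by (simp add: E1_def)
    have eq: "sym_diff E E1 = sym_diff (sym_diff E E') D" by (auto simp: E1_def)
    show ?case
    proof (cases "E = E1")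
      case True
      then show ?thesis using one S by simp
    next
      case False
      then obtain m where m: "(E, E1) \<in> S ^^ m" "2 * (m + 1) \<le> card (sym_diff E E1)"
        using less.hyps[of E E1] D(2) less.prems(1) S unfolding eq by (auto simp: S_def)
      have "(E, E') \<in> S ^^ Suc m" using m(1) S by (rule relpow_Suc_I)
      then show ?thesis using m(2) D(2) unfolding eq by (intro exI[of _ "Suc m"]) simp
    qed
  qed
qed

theorem corollary3:
  fixes v u :: "'a list" and a b :: "nat list" and F\<^sub>E F\<^sub>N E E' :: "'a set set"
  assumes "distinct v" and "distinct u" and "set v \<inter> set u = {}"
    and "length a = length v" and "length b = length u"
    and "\<forall>x \<in> set a. 0 < x" and "\<forall>x \<in> set b. 0 < x"
    and "F\<^sub>E \<subseteq> vertex_pairs (set v) (set u)" and "F\<^sub>N \<subseteq> vertex_pairs (set v) (set u)"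
    and "is_forest (F\<^sub>E \<union> F\<^sub>N)"
    and "fixed_realisation v u a b F\<^sub>E F\<^sub>N E"
    and "fixed_realisation v u a b F\<^sub>E F\<^sub>N E'"
    and "E \<noteq> E'"
  shows "\<exists>(k::nat) (G :: nat \<Rightarrow> 'a set set).
    1 \<le> k \<and> G 1 = E \<and> G k = E' \<and>
    (\<forall>i\<in>{1..k}. fixed_realisation v u a b F\<^sub>E F\<^sub>N (G i)) \<and>
    real k \<le> 1 / 2 * real (card (sym_diff E E')) \<and>
    (\<forall>i. 1 \<le> i \<and> i < k \<longrightarrow>
       card (sym_diff (G i) (G (i + 1))) \<le> 6 \<and>
       (corresponds_to_swap (set v) (set u) 4 (G i) (sym_diff (G i) (G (i + 1))) \<or>
        corresponds_to_swap (set v) (set u) 6 (G i) (sym_diff (G i) (G (i + 1)))))"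
proof -
  obtain m where m: "(E, E') \<in> {(X, Y). swap46 (set v) (set u) X (sym_diff X Y) \<and>
      fixed_realisation v u a b F\<^sub>E F\<^sub>N X \<and> fixed_realisation v u a b F\<^sub>E F\<^sub>N Y} ^^ m"
      "2 * (m + 1) \<le> card (sym_diff E E')"
    using swap_sequence assms by blast
  then obtain f where f: "f 0 = E" "f m = E'"
      "\<And>i. i < m \<Longrightarrow> swap46 (set v) (set u) (f i) (sym_diff (f i) (f (Suc i))) \<and>
        fixed_realisation v u a b F\<^sub>E F\<^sub>N (f i)"
    unfolding relpow_fun_conv by auto
  \<comment> \<open>The relation gives this for the source of each step; the final graph is
    \<open>E'\<close>, a realisation by hypothesis.\<close>
  have real: "fixed_realisation v u a b F\<^sub>E F\<^sub>N (f i)" if "i \<le> m" for i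
    using that f(2,3) assms(12) by (cases "i = m") auto
  have swap: "swap46 (set v) (set u) (f (i - 1)) (sym_diff (f (i - 1)) (f i))"
    if "1 \<le> i" "i < m + 1" for i
    using f(3)[of "i - 1"] that by simp
  have card: "card (sym_diff (f (i - 1)) (f i)) \<le> 6" if "1 \<le> i" "i < m + 1" for i
    using swap[OF that] by (auto simp: swap46_def dest!: card_corresponds_to_swap)
  \<comment> \<open>The chain \<open>f\<close> counts from 0 and the sequence \<open>G\<close> from
    1, hence \<open>k = m + 1\<close> and the index \<open>i - 1\<close>.\<close>
  show ?thesis
    using f(1,2) real swap card m(2)
    by (intro exI[of _ "m + 1"] exI[of _ "\<lambda>i. f (i - 1)"]) (auto simp: swap46_def)
qed

end
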